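(* If $T$ is a tree of order $n$ and independence number $\alpha$, then $$\sharp\alpha(T)\leq \begin{cases}2^{n-\alpha-1}+1 & \mbox{, if } 2\alpha=n, \mbox{ and}\\ 2^{n-\alpha-1} & \mbox{, if } 2\alpha>n.\end{cases}$$ Furthermore, equality holds in this inequality if and only if $T$ arises by subdividing $n-\alpha-1$ edges of $K_{1,\alpha}$ once.
   Context: All graphs are finite, simple, and undirected. The order of a graph is its number of vertices. An independent set in a graph is a set of pairwise non-adjacent vertices, and the independence number of a graph is the maximum cardinality of an independent set in it. An independent set is maximum if its cardinality equals the independence number, and $\sharp\alpha(G)$ denotes the number of maximum independent sets in a graph $G$. $K_{1,\alpha}$ is the star with $\alpha$ edges. Subdividing $m$ edges of a graph once means choosing $m$ distinct edges and replacing each chosen edge $uv$ by a path $u w v$ with a new vertex $w$.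
   Formalization: The formal theorem assumes that the tree has order n at least 2; for the one-vertex tree the stated bound would be 1/2, while there is one maximum independent set. *)

theory Defs
  imports "Graph_Theory.Graph_Theory"
begin

text \<open>
  A finite simple undirected graph is a \<^locale>\<open>pair_graph\<close>: an edge \<open>uv\<close> is represented by the
  two arcs \<open>(u,v)\<close> and \<open>(v,u)\<close>.
\<close>

text \<open>
  The library constant \<^const>\<open>tree\<close> is not usable for graphs in this representation: it forbids every
  directed cycle, in particular the closed walk \<open>u, v, u\<close> along a single edge. The cycles of the
  undirected graph are the \<^const>\<open>pre_digraph.cycle\<close>s of length at least three.
\<close>

definition undirected_tree :: "'a pair_pre_digraph \<Rightarrow> bool" where
  "undirected_tree G \<longleftrightarrow> pair_graph G \<and> Digraph_Component.connected (with_proj G) \<and>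
     \<not> (\<exists>p. pre_digraph.cycle (with_proj G) p \<and> 3 \<le> length p)"

definition independent_sets :: "'a pair_pre_digraph \<Rightarrow> 'a set set" where
  "independent_sets G = {S. S \<subseteq> pverts G \<and> (\<forall>u\<in>S. \<forall>v\<in>S. (u, v) \<notin> parcs G)}"

definition independence_number :: "'a pair_pre_digraph \<Rightarrow> nat" where
  "independence_number G = Max (card ` independent_sets G)"

definition num_max_independent_sets :: "'a pair_pre_digraph \<Rightarrow> nat" where
  "num_max_independent_sets G =
     card {S \<in> independent_sets G. card S = independence_number G}"

definition edges :: "'a pair_pre_digraph \<Rightarrow> 'a set set" where
  "edges G = {{u, v} | u v. (u, v) \<in> parcs G}"

text \<open>
  \<open>w e\<close> is the new vertex on the edge \<open>e \<in> F\<close>. Since both orientations of \<open>e = uv\<close> occur in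
  \<open>parcs G\<close>, the last two sets contribute all four arcs of the path \<open>u, w e, v\<close>.
\<close>

definition subdivide_edges ::
    "'a pair_pre_digraph \<Rightarrow> 'a set set \<Rightarrow> ('a set \<Rightarrow> 'a) \<Rightarrow> 'a pair_pre_digraph" where
  "subdivide_edges G F w =
     \<lparr> pverts = pverts G \<union> w ` F,
       parcs = {(u, v). (u, v) \<in> parcs G \<and> {u, v} \<notin> F}
             \<union> {(u, w {u, v}) | u v. (u, v) \<in> parcs G \<and> {u, v} \<in> F}
             \<union> {(w {u, v}, u) | u v. (u, v) \<in> parcs G \<and> {u, v} \<in> F} \<rparr>"

definition arises_by_subdividing :: "nat \<Rightarrow> 'a pair_pre_digraph \<Rightarrow> 'a pair_pre_digraph \<Rightarrow> bool" where
  "arises_by_subdividing m G H \<longleftrightarrow>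
     (\<exists>F w. F \<subseteq> edges G \<and> finite F \<and> card F = m \<and> inj_on w F \<and> w ` F \<inter> pverts G = {} \<and>
            H = subdivide_edges G F w)"

text \<open>For a single edge this is the subdivision operation of the library.\<close>

lemma (in pair_graph) subdivide_edges_single:
  assumes "(u, v) \<in> parcs G"
  shows "subdivide_edges G {{u, v}} (\<lambda>_. x) = subdivide G (u, v) x"
proof -
  have "(v, u) \<in> parcs G"
    using assms arcs_symmetric by blast
  with assms show ?thesis
    by (auto simp: subdivide_edges_def subdivide.simps doubleton_eq_iff)
qed

end

theory Submission
  imports Defs
begin

text \<open>
  Removing leaves greedily yields a matching of size \<open>\<mu> = n - \<alpha>\<close> one end of each of whose edges lies in
  a vertex cover of size \<open>\<mu>\<close>. So a maximum independent set contains exactly one end of each matching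
  edge and every unmatched vertex. Hence at most \<open>2 ^ (\<mu> - 1)\<close> of them avoid a given matched vertex
  \<open>c\<close>, and if that bound is attained, every edge either belongs to the matching or contains \<open>c\<close>, which in
  a tree forces a subdivided star with centre \<open>c\<close>.

  If \<open>2\<alpha> > n\<close>, there is an unmatched vertex, and its neighbour is such a \<open>c\<close> avoided by all maximum
  independent sets. If \<open>2\<alpha> = n\<close>, the matching is perfect and the tree is exhausted by adding one matching
  edge at a time; attaching the \<open>k\<close>-th one at a vertex \<open>c\<close> adds at most the \<open>2 ^ (k - 2)\<close> sets that
  avoid \<open>c\<close>.
\<close>

section \<open>Independent transversals of a matching\<close>

definition stable_set :: "'a rel \<Rightarrow> 'a set \<Rightarrow> bool" where
  "stable_set E S \<longleftrightarrow> (\<forall>u\<in>S. \<forall>v\<in>S. (u, v) \<notin> E)"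

text \<open>
  A matching is encoded as an involution \<open>f\<close> of \<open>V\<close> that swaps the two ends of each matching edge and
  fixes the unmatched vertices; \<open>A\<close> contains one end of each matching edge.
\<close>

definition matching :: "'a rel \<Rightarrow> ('a \<Rightarrow> 'a) \<Rightarrow> 'a set \<Rightarrow> 'a set \<Rightarrow> bool" where
  "matching E f A V \<longleftrightarrow> A \<subseteq> V \<and> (\<forall>x\<in>V. f x \<in> V \<and> f (f x) = x \<and> (f x \<noteq> x \<longrightarrow> (x \<in> A \<longleftrightarrow> f x \<notin> A)))
     \<and> (\<forall>x\<in>A. f x \<noteq> x \<and> (x, f x) \<in> E)"

text \<open>These are the candidates for maximum independent sets. Independence is left out so that
  the choices on different pairs are free, which makes transversals easy to count and to
  extend.\<close>

definition transversals :: "('a \<Rightarrow> 'a) \<Rightarrow> 'a set \<Rightarrow> 'a set set" where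
  "transversals f V = {S. S \<subseteq> V \<and> (\<forall>x\<in>V. x \<in> S \<longleftrightarrow> f x = x \<or> f x \<notin> S)}"

definition indep_transversals :: "'a rel \<Rightarrow> ('a \<Rightarrow> 'a) \<Rightarrow> 'a set \<Rightarrow> 'a set set" where
  "indep_transversals E f V = {S \<in> transversals f V. stable_set E S}"

lemma finite_transversals: "finite V \<Longrightarrow> finite (transversals f V)"
  by (rule finite_subset[of _ "Pow V"]) (auto simp: transversals_def)

lemma finite_indep_transversals: "finite V \<Longrightarrow> finite (indep_transversals E f V)"
  by (simp add: indep_transversals_def finite_transversals)

lemma stable_set_mono: "stable_set E S \<Longrightarrow> R \<subseteq> S \<Longrightarrow> stable_set E R"
  by (auto simp: stable_set_def)

lemma matchingD:
  assumes "matching E f A V"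
  shows "A \<subseteq> V" "\<And>x. x \<in> V \<Longrightarrow> f x \<in> V" "\<And>x. x \<in> V \<Longrightarrow> f (f x) = x"
    "\<And>x. x \<in> V \<Longrightarrow> f x \<noteq> x \<Longrightarrow> x \<in> A \<longleftrightarrow> f x \<notin> A" "\<And>x. x \<in> A \<Longrightarrow> f x \<noteq> x"
    "\<And>x. x \<in> A \<Longrightarrow> (x, f x) \<in> E"
  using assms unfolding matching_def by blast+

lemma matching_restrict:
  assumes "matching E f A V" "W \<subseteq> V" "\<And>x. x \<in> W \<Longrightarrow> f x \<in> W"
  shows "matching E f (A \<inter> W) W"
  using assms unfolding matching_def by blast

lemma matched_edge:
  assumes "matching E f A V" "sym E" "x \<in> V" "f x \<noteq> x"
  shows "(x, f x) \<in> E"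
  using matchingD[OF assms(1)] assms(2-4) by (metis symE)

text \<open>A transversal is determined by its trace on \<open>A\<close>. Avoiding a matched
  \<open>c\<close> settles the choice on the pair of \<open>c\<close>, so only the
  \<open>card A - 1\<close> other pairs stay open; an unmatched \<open>c\<close> lies in every
  transversal.\<close>

lemma card_transversals_avoiding:
  assumes m: "matching E f A V" and fin: "finite V" and c: "c \<in> V"
  shows "card {S \<in> transversals f V. c \<notin> S} \<le> 2 ^ (card A - 1)"
proof (cases "f c = c")
  case True
  then have "{S \<in> transversals f V. c \<notin> S} = {}"
    using c by (auto simp: transversals_def)
  then show ?thesis by (simp only: card.empty)
next
  case False
  let ?B = "A - {c, f c}"
  note M = matchingD[OF m]
  have finA: "finite A" using M(1) fin finite_subset by blast
  have "inj_on (\<lambda>S. S \<inter> ?B) {S \<in> transversals f V. c \<notin> S}"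
  proof (rule inj_onI)
    fix S R assume S: "S \<in> {S \<in> transversals f V. c \<notin> S}" and R: "R \<in> {S \<in> transversals f V. c \<notin> S}"
      and eq: "S \<inter> ?B = R \<inter> ?B"
    have tS: "\<And>x. x \<in> V \<Longrightarrow> x \<in> S \<longleftrightarrow> f x = x \<or> f x \<notin> S" "S \<subseteq> V" "c \<notin> S"
      and tR: "\<And>x. x \<in> V \<Longrightarrow> x \<in> R \<longleftrightarrow> f x = x \<or> f x \<notin> R" "R \<subseteq> V" "c \<notin> R"
      using S R by (auto simp: transversals_def)
    have A: "x \<in> S \<longleftrightarrow> x \<in> R" if "x \<in> A" for x
    proof (cases "x \<in> ?B")
      case True then show ?thesis using eq by blast
    next
      case False
      then have "x = c \<or> x = f c" using that by blast
      then show ?thesis using tS tR c M(2,3) by metis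
    qed
    have "x \<in> S \<longleftrightarrow> x \<in> R" if "x \<in> V" for x
      using A M(2-4) that tS(1)[OF that] tR(1)[OF that] by metis
    then show "S = R" using tS(2) tR(2) by blast
  qed
  then have "card {S \<in> transversals f V. c \<notin> S} \<le> card (Pow ?B)"
    by (rule card_inj_on_le) (auto simp: finA)
  also have "card (Pow ?B) = 2 ^ card ?B" using finA by (simp add: card_Pow)
  also have "card ?B = card A - 1"
  proof -
    have "c \<in> A \<and> f c \<notin> A \<or> c \<notin> A \<and> f c \<in> A" using M(4)[OF c False] by blast
    then have "A - {c, f c} = A - {c} \<and> c \<in> A \<or> A - {c, f c} = A - {f c} \<and> f c \<in> A" by blast
    then show ?thesis by (metis card_Diff_singleton)
  qed
  finally show ?thesis .
qed

text \<open>The pairs not met by \<open>P\<close> choose their end outside \<open>A\<close>.\<close>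

lemma transversal_extending:
  assumes m: "matching E f A V" and P: "P \<subseteq> V" "\<And>p. p \<in> P \<Longrightarrow> f p \<in> P \<Longrightarrow> f p = p"
  obtains S where "S \<in> transversals f V" "P \<subseteq> S"
proof
  let ?S = "{v \<in> V. v \<in> P \<or> f v \<notin> P \<and> v \<notin> A}"
  note M = matchingD[OF m]
  show "P \<subseteq> ?S" using P by blast
  have "x \<in> ?S \<longleftrightarrow> f x = x \<or> f x \<notin> ?S" if "x \<in> V" for x
    using M(2-5) P(2) that by (smt (verit, best) mem_Collect_eq)
  then show "?S \<in> transversals f V" by (auto simp: transversals_def)
qed

text \<open>If all transversals avoiding \<open>c\<close> are independent, an edge \<open>yz\<close> off the matching must contain
  \<open>c\<close>, since otherwise some transversal contains \<open>y\<close> and \<open>z\<close> and avoids \<open>c\<close>.\<close>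

lemma edges_if_all_transversals_avoiding:
  assumes m: "matching E f A V" and fin: "finite V" and irr: "irrefl E"
    and c: "c \<in> V" "f c \<noteq> c"
    and full: "2 ^ (card A - 1) \<le> card {S \<in> indep_transversals E f V. c \<notin> S}"
    and e: "(y, z) \<in> E" "y \<in> V" "z \<in> V" "y \<noteq> c" "z \<noteq> c"
  shows "z = f y"
proof (rule ccontr)
  assume nz: "z \<noteq> f y"
  note M = matchingD[OF m]
  have yz: "y \<noteq> z" using e(1) irr by (auto simp: irrefl_def)
  \<comment> \<open>The independent transversals avoiding \<open>c\<close> already attain the bound
    for all transversals avoiding \<open>c\<close>, so the two families coincide.\<close>
  have "{S \<in> indep_transversals E f V. c \<notin> S} = {S \<in> transversals f V. c \<notin> S}"
  proof (rule card_subset_eq)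
    show "finite {S \<in> transversals f V. c \<notin> S}" using fin by (simp add: finite_transversals)
    show sub: "{S \<in> indep_transversals E f V. c \<notin> S} \<subseteq> {S \<in> transversals f V. c \<notin> S}"
      by (auto simp: indep_transversals_def)
    show "card {S \<in> indep_transversals E f V. c \<notin> S} = card {S \<in> transversals f V. c \<notin> S}"
      using full card_transversals_avoiding[OF m fin c(1)] card_mono[OF _ sub] fin
      by (simp add: finite_transversals)
  qed
  \<comment> \<open>Prescribing \<open>f c\<close> keeps \<open>c\<close> out of the
    transversal.\<close>
  moreover obtain S where S: "S \<in> transversals f V" "{y, z, f c} \<subseteq> S"
  proof (rule transversal_extending[OF m])
    show "{y, z, f c} \<subseteq> V" using e c M(2) by blast
    show "f p = p" if "p \<in> {y, z, f c}" "f p \<in> {y, z, f c}" for p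
      using that nz yz e c M(3) by (smt (verit, best) insert_iff empty_iff)
  qed
  moreover have "c \<notin> S" using S c by (auto simp: transversals_def)
  ultimately have "stable_set E S" by (auto simp: indep_transversals_def)
  then show False using S e(1) by (auto simp: stable_set_def)
qed

text \<open>A further matching edge \<open>x, f x\<close> attached at \<open>c\<close> through \<open>x\<close>: the transversals through \<open>f x\<close>
  number at most those of \<open>W\<close>, and those through \<open>x\<close> avoid \<open>c\<close>.\<close>

lemma card_indep_transversals_add_pair:
  assumes m: "matching E f A (W \<union> {x, f x})" and fin: "finite W" and irr: "irrefl E"
    and W: "\<And>v. v \<in> W \<Longrightarrow> f v \<in> W \<and> f v \<noteq> v"
    and x: "x \<notin> W" "f x \<noteq> x" and c: "c \<in> W" "(c, x) \<in> E"
    and bound: "card (indep_transversals E f W) \<le> 2 ^ (card (A \<inter> W) - 1) + 1"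
  shows "card (indep_transversals E f (W \<union> {x, f x})) \<le> 2 ^ (card A - 1) + 1"
    and "card (indep_transversals E f (W \<union> {x, f x})) = 2 ^ (card A - 1) + 1 \<Longrightarrow>
      (y, z) \<in> E \<Longrightarrow> {y, z} \<subseteq> W \<union> {x, f x} \<Longrightarrow> y \<noteq> c \<Longrightarrow> z \<noteq> c \<Longrightarrow> z = f y"
proof -
  let ?V = "W \<union> {x, f x}"
  let ?I = "indep_transversals E f"
  note M = matchingD[OF m]
  have ffx: "f (f x) = x" using M(3) by blast
  have fx: "f x \<notin> W" using W[of "f x"] ffx x(1) by auto
  have mW: "matching E f (A \<inter> W) W" using matching_restrict[OF m] W by blast
  have finV: "finite ?V" and finA: "finite A" using fin M(1) finite_subset by auto
  note finI = finite_indep_transversals fin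
  have cA: "card A = card (A \<inter> W) + 1"
  proof -
    have "\<exists>p. A = insert p (A \<inter> W) \<and> p \<notin> W"
    proof (cases "x \<in> A")
      case True then have "f x \<notin> A" using M(4)[of x] x by blast
      then have "A = insert x (A \<inter> W)" using True M(1) by blast
      then show ?thesis using x by blast
    next
      case False then have "f x \<in> A" using M(4)[of x] x by blast
      then have "A = insert (f x) (A \<inter> W)" using False M(1) by blast
      then show ?thesis using fx by blast
    qed
    then obtain p where "A = insert p (A \<inter> W)" "p \<notin> W" by blast
    then show ?thesis using finA by (metis IntD2 Suc_eq_plus1 card_insert_disjoint finite_Int)
  qed
  \<comment> \<open>The pair of \<open>c\<close> lies in \<open>W\<close>. Hence
    \<open>k - 1\<close> below is not truncated and the power for \<open>A\<close> is twice that for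
    \<open>W\<close>.\<close>
  have pos: "card (A \<inter> W) \<ge> 1"
  proof -
    have "c \<in> A \<inter> W \<or> f c \<in> A \<inter> W" using M(4)[of c] W c by blast
    then show ?thesis using finA by (metis One_nat_def Suc_leI card_gt_0_iff empty_iff finite_Int)
  qed
  define k where "k = card (A \<inter> W)"
  have pow: "2 ^ (card A - 1) = 2 ^ (k - 1) + (2 ^ (k - 1) :: nat)"
    using pos cA by (cases k) (auto simp: k_def)
  let ?Nx = "{S \<in> ?I ?V. x \<in> S}"
  let ?Ny = "{S \<in> ?I ?V. f x \<in> S}"
  let ?cW = "{S \<in> ?I W. c \<notin> S}"
  have tV: "S \<subseteq> ?V" "\<And>v. v \<in> ?V \<Longrightarrow> v \<in> S \<longleftrightarrow> f v = v \<or> f v \<notin> S" "stable_set E S"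
    if "S \<in> ?I ?V" for S using that by (auto simp: indep_transversals_def transversals_def)
  have split: "x \<in> S \<longleftrightarrow> f x \<notin> S" if "S \<in> ?I ?V" for S
    using tV(2)[OF that, of x] x by blast
  have res: "S \<inter> W \<in> ?I W" if "S \<in> ?I ?V" for S
    using tV[OF that] W stable_set_mono[of E S "S \<inter> W"]
    by (auto simp: indep_transversals_def transversals_def)
  \<comment> \<open>The edge from \<open>c\<close> to \<open>x\<close> keeps \<open>c\<close> out of
    every independent set through \<open>x\<close>.\<close>
  have resx: "(\<lambda>S. S \<inter> W) ` ?Nx \<subseteq> ?cW"
    using res tV(3) c by (auto simp: stable_set_def)
  have eqI: "S = R" if "S \<in> ?I ?V" "R \<in> ?I ?V" "x \<in> S \<longleftrightarrow> x \<in> R" "S \<inter> W = R \<inter> W" for S R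
    using that split[OF that(1)] split[OF that(2)] tV(1)[OF that(1)] tV(1)[OF that(2)] by blast
  have injx: "inj_on (\<lambda>S. S \<inter> W) ?Nx" and injy: "inj_on (\<lambda>S. S \<inter> W) ?Ny"
    unfolding inj_on_def using eqI split by blast+
  have I: "?I ?V = ?Nx \<union> ?Ny" "?Nx \<inter> ?Ny = {}" using split by blast+
  have card: "card (?I ?V) = card ?Nx + card ?Ny"
    by (rule trans[OF arg_cong[OF I(1), of card] card_Un_disjoint[OF _ _ I(2)]]) (auto simp: finI)
  have Nx: "card ?Nx \<le> card ?cW"
    by (rule card_inj_on_le[OF injx resx]) (simp add: finI)
  have cW: "card ?cW \<le> 2 ^ (k - 1)"
  proof -
    have "card ?cW \<le> card {S \<in> transversals f W. c \<notin> S}"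
      by (rule card_mono) (auto simp: indep_transversals_def fin finite_transversals)
    then show ?thesis using card_transversals_avoiding[OF mW fin c(1)] by (simp add: k_def)
  qed
  have Ny: "card ?Ny \<le> card (?I W)"
    by (rule card_inj_on_le[OF injy]) (use res in \<open>auto simp: finI\<close>)
  show "card (?I ?V) \<le> 2 ^ (card A - 1) + 1"
    using card Nx Ny cW bound pow by (simp add: k_def)
  \<comment> \<open>Equality makes all estimates tight. Restriction then maps the sets through
    \<open>f x\<close> onto all independent transversals of \<open>W\<close>, so those avoiding
    \<open>c\<close> lift. Together with the sets through \<open>x\<close> they give
    \<open>2 ^ (card A - 1)\<close> sets avoiding \<open>c\<close>.\<close>
  assume eq: "card (?I ?V) = 2 ^ (card A - 1) + 1" and e: "(y, z) \<in> E" "{y, z} \<subseteq> ?V" "y \<noteq> c" "z \<noteq> c"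
  have Nx': "card ?Nx = 2 ^ (k - 1)" "card ?cW = 2 ^ (k - 1)" and Ny': "card ?Ny = card (?I W)"
    using eq card Nx Ny cW bound pow by (simp_all add: k_def)
  have im: "(\<lambda>S. S \<inter> W) ` ?Ny = ?I W"
    by (rule card_subset_eq) (use res Ny' card_image[OF injy] in \<open>auto simp: finI\<close>)
  let ?Cy = "{S \<in> ?Ny. c \<notin> S}"
  have "?cW \<subseteq> (\<lambda>S. S \<inter> W) ` ?Cy"
  proof
    fix R assume R: "R \<in> ?cW"
    then obtain S where "S \<in> ?Ny" "R = S \<inter> W" using im by blast
    then show "R \<in> (\<lambda>S. S \<inter> W) ` ?Cy" using R c(1) by blast
  qed
  then have "card ?cW \<le> card ?Cy"
    by (rule surj_card_le[rotated]) (simp add: finI)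
  then have "2 ^ (k - 1) \<le> card ?Cy" unfolding Nx'(2) .
  moreover have "card (?Nx \<union> ?Cy) = card ?Nx + card ?Cy"
    by (rule card_Un_disjoint) (use I(2) in \<open>auto simp: finI\<close>)
  moreover have "card (?Nx \<union> ?Cy) \<le> card {S \<in> ?I ?V. c \<notin> S}"
    by (rule card_mono) (use resx c(1) in \<open>auto simp: finI\<close>)
  ultimately have "2 ^ (card A - 1) \<le> card {S \<in> ?I ?V. c \<notin> S}" using Nx' pow by simp
  then show "z = f y"
    using edges_if_all_transversals_avoiding[OF m finV irr _ _ _ e(1)] c W e(2-) by blast
qed

text \<open>By connectivity some arc leaves \<open>W\<close>, and the matching pair of its head is
  added to \<open>W\<close> until \<open>V\<close> is exhausted. Only the last addition matters for
  the equality case; it supplies the centre \<open>c\<close>.\<close>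

lemma card_indep_transversals_connected:
  assumes m: "matching E f A V" and fin: "finite V" and irr: "irrefl E"
    and nofix: "\<And>v. v \<in> V \<Longrightarrow> f v \<noteq> v"
    and conn: "\<And>W. W \<subset> V \<Longrightarrow> W \<noteq> {} \<Longrightarrow> \<exists>c\<in>W. \<exists>x\<in>V - W. (c, x) \<in> E"
    and W: "W \<subset> V" "W \<noteq> {}" "\<And>v. v \<in> W \<Longrightarrow> f v \<in> W"
    and bound: "card (indep_transversals E f W) \<le> 2 ^ (card (A \<inter> W) - 1) + 1"
  shows "card (indep_transversals E f V) \<le> 2 ^ (card A - 1) + 1 \<and>
    (card (indep_transversals E f V) = 2 ^ (card A - 1) + 1 \<longrightarrow>
      (\<exists>c\<in>V. \<forall>y\<in>V. \<forall>z\<in>V. (y, z) \<in> E \<longrightarrow> y \<noteq> c \<longrightarrow> z \<noteq> c \<longrightarrow> z = f y))"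
  using W bound
proof (induction "card (V - W)" arbitrary: W rule: less_induct)
  case less
  note M = matchingD[OF m]
  obtain c x where cx: "c \<in> W" "x \<in> V" "x \<notin> W" "(c, x) \<in> E"
    using conn[OF less.prems(1,2)] by blast
  let ?W = "W \<union> {x, f x}"
  have sub: "?W \<subseteq> V" using less.prems(1) cx M(2) by blast
  have cl: "f v \<in> ?W" if "v \<in> ?W" for v
    using that less.prems(3) M(3)[OF cx(2)] by auto
  have mW: "matching E f (A \<inter> ?W) ?W" using matching_restrict[OF m sub cl] .
  have AW: "A \<inter> ?W \<inter> W = A \<inter> W" by blast
  have finW: "finite W" using less.prems(1) fin finite_subset by blast
  have clW: "f v \<in> W \<and> f v \<noteq> v" if "v \<in> W" for v
    using that less.prems(1,3) nofix by blast
  note step = card_indep_transversals_add_pair[OF mW finW irr clW cx(3) nofix[OF cx(2)] cx(1,4),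
      unfolded AW, OF _ less.prems(4)]
  show ?case
  proof (cases "?W = V")
    case True
    then have A: "A \<inter> ?W = A" using M(1) by blast
    have "z = f y" if "card (indep_transversals E f V) = 2 ^ (card A - 1) + 1"
      "y \<in> V" "z \<in> V" "(y, z) \<in> E" "y \<noteq> c" "z \<noteq> c" for y z
      using step(2)[of y z] that unfolding A unfolding True by blast
    moreover have "c \<in> V" using less.prems(1) cx(1) by blast
    moreover have "card (indep_transversals E f V) \<le> 2 ^ (card A - 1) + 1"
      using step(1) unfolding A unfolding True by blast
    ultimately show ?thesis by blast
  next
    case False
    show ?thesis
    proof (rule less.hyps)
      show "card (V - ?W) < card (V - W)"
        by (rule psubset_card_mono) (use fin cx in auto)
      show "?W \<subset> V" using False sub by blast
    qed (use cl step(1) in auto)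
  qed
qed

text \<open>The growth starts from a single matching edge, which has at most two independent
  transversals and so respects the bound because \<open>2 \<le> 2 ^ k + 1\<close>.\<close>

lemma card_indep_transversals_perfect:
  assumes m: "matching E f A V" and fin: "finite V" and irr: "irrefl E" and ne: "V \<noteq> {}"
    and nofix: "\<And>v. v \<in> V \<Longrightarrow> f v \<noteq> v"
    and conn: "\<And>W. W \<subset> V \<Longrightarrow> W \<noteq> {} \<Longrightarrow> \<exists>c\<in>W. \<exists>x\<in>V - W. (c, x) \<in> E"
  shows "card (indep_transversals E f V) \<le> 2 ^ (card A - 1) + 1 \<and>
    (card (indep_transversals E f V) = 2 ^ (card A - 1) + 1 \<longrightarrow>
      (\<exists>c\<in>V. \<forall>y\<in>V. \<forall>z\<in>V. (y, z) \<in> E \<longrightarrow> y \<noteq> c \<longrightarrow> z \<noteq> c \<longrightarrow> z = f y))"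
proof -
  note M = matchingD[OF m]
  obtain v where v: "v \<in> V" using ne by blast
  let ?W = "{v, f v}"
  have sub: "?W \<subseteq> V" using v M(2) by blast
  have cl: "f w \<in> ?W" if "w \<in> ?W" for w using that M(3)[OF v] by auto
  have "indep_transversals E f ?W \<subseteq> {{v}, {f v}}"
    using nofix[OF v] unfolding indep_transversals_def transversals_def by blast
  then have "card (indep_transversals E f ?W) \<le> card {{v}, {f v}}"
    by (rule card_mono[rotated]) simp
  also have "card {{v}, {f v}} \<le> 2" by (simp add: card_insert_if)
  finally have bound: "card (indep_transversals E f ?W) \<le> 2" .
  show ?thesis
  proof (cases "?W = V")
    case True
    have "card (indep_transversals E f V) \<le> 2 ^ (card A - 1) + 1"
      using bound True by (metis add_mono_thms_linordered_semiring(3) le_trans nat_1_add_1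
          one_le_numeral one_le_power)
    \<comment> \<open>An edge inside \<open>{v, f v}\<close> that avoids \<open>v\<close> would be a
      loop.\<close>
    moreover have "\<forall>y\<in>V. \<forall>z\<in>V. (y, z) \<in> E \<longrightarrow> y \<noteq> v \<longrightarrow> z \<noteq> v \<longrightarrow> z = f y"
      using irr unfolding True[symmetric] irrefl_def by blast
    ultimately show ?thesis using v by blast
  next
    case False
    have "card (indep_transversals E f ?W) \<le> 2 ^ (card (A \<inter> ?W) - 1) + 1"
      using bound by (metis add_mono_thms_linordered_semiring(3) le_trans nat_1_add_1
          one_le_numeral one_le_power)
    then show ?thesis
      using card_indep_transversals_connected[OF m fin irr nofix conn _ _ cl] sub False by blast
  qed
qed

text \<open>The unmatched \<open>u\<close> lies in every transversal, so its neighbour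
  \<open>c\<close> lies in no independent one, and the results on sets avoiding \<open>c\<close>
  apply to all of them.\<close>

lemma card_indep_transversals_unmatched:
  assumes m: "matching E f A V" and fin: "finite V" and irr: "irrefl E"
    and u: "u \<in> V" "f u = u" and c: "c \<in> V" "f c \<noteq> c" "(u, c) \<in> E"
  shows "card (indep_transversals E f V) \<le> 2 ^ (card A - 1) \<and>
    (card (indep_transversals E f V) = 2 ^ (card A - 1) \<longrightarrow>
      (\<forall>y\<in>V. \<forall>z\<in>V. (y, z) \<in> E \<longrightarrow> y \<noteq> c \<longrightarrow> z \<noteq> c \<longrightarrow> z = f y))"
proof -
  have eq: "indep_transversals E f V = {S \<in> indep_transversals E f V. c \<notin> S}"
    using u c by (auto simp: indep_transversals_def transversals_def stable_set_def)
  have "card {S \<in> indep_transversals E f V. c \<notin> S} \<le> card {S \<in> transversals f V. c \<notin> S}"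
    by (rule card_mono) (auto simp: indep_transversals_def fin finite_transversals)
  then have "card (indep_transversals E f V) \<le> 2 ^ (card A - 1)"
    using card_transversals_avoiding[OF m fin c(1)] eq by simp
  moreover have "z = f y" if "card (indep_transversals E f V) = 2 ^ (card A - 1)"
    "y \<in> V" "z \<in> V" "(y, z) \<in> E" "y \<noteq> c" "z \<noteq> c" for y z
    by (rule edges_if_all_transversals_avoiding[OF m fin irr c(1,2)]) (use that eq in auto)
  ultimately show ?thesis by blast
qed

section \<open>Maximum matchings of trees\<close>

text \<open>Each matching edge has an end outside \<open>S\<close>; \<open>g\<close> chooses one,
  which injects \<open>A\<close> into \<open>V - S\<close>. In the equality case \<open>g\<close> is
  onto, so \<open>S\<close> misses no unmatched vertex and only one end of each pair.\<close>

lemma stable_set_matching_bound: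
  assumes m: "matching E f A V" and fin: "finite V" and sym: "sym E"
    and S: "S \<subseteq> V" "stable_set E S"
  shows "card S + card A \<le> card V"
    and "card S + card A = card V \<Longrightarrow> S \<in> transversals f V"
proof -
  note M = matchingD[OF m]
  define g where "g a = (if a \<in> S then f a else a)" for a
  have inj: "inj_on g A"
  proof (rule inj_onI)
    fix a b assume "a \<in> A" "b \<in> A" "g a = g b"
    then show "a = b" using M(1,3-5) unfolding g_def by (metis subsetD)
  qed
  have img: "g ` A \<subseteq> V - S"
  proof
    fix v assume "v \<in> g ` A"
    then obtain a where a: "a \<in> A" "v = g a" by blast
    then have "a \<in> V" "\<not> (a \<in> S \<and> f a \<in> S)"
      using M(1,6) S(2) unfolding stable_set_def by blast+
    then show "v \<in> V - S" using a(2) M(2) by (auto simp: g_def)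
  qed
  have fS: "finite S" using S(1) fin finite_subset by blast
  have VS: "card (V - S) + card S = card V"
    using S(1) fin fS by (simp add: card_Diff_subset card_mono)
  have "card A \<le> card (V - S)"
    using card_inj_on_le[OF inj img] fin by simp
  then show "card S + card A \<le> card V" using VS by simp
  assume "card S + card A = card V"
  then have im: "g ` A = V - S"
    using img VS card_image[OF inj] fin by (intro card_subset_eq) auto
  have "x \<in> S \<longleftrightarrow> f x = x \<or> f x \<notin> S" if x: "x \<in> V" for x
  proof (cases "x \<in> S")
    case True
    then show ?thesis using matched_edge[OF m sym x] S(2) unfolding stable_set_def by blast
  next
    case False
    then obtain a where a: "a \<in> A" "x = g a" using im x by blast
    show ?thesis
    proof (cases "a \<in> S")
      case True
      then show ?thesis using a False M(1,3) by (auto simp: g_def)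
    next
      case a': False
      then have xa: "x = a" using a by (simp add: g_def)
      \<comment> \<open>Otherwise \<open>f a\<close> would be the end that \<open>g\<close> chose
        for some pair. That pair can only be its own, but there \<open>g\<close> chose
        \<open>a\<close>.\<close>
      have "f a \<in> S"
      proof (rule ccontr)
        assume "f a \<notin> S"
        then obtain b where b: "b \<in> A" "f a = g b" using im x xa M(2) by blast
        then have "b \<in> S" using M(1,4,5) a(1) unfolding g_def by (metis subsetD)
        then have "a = b" using a(1) b M(1,3) unfolding g_def by (metis subsetD)
        then show False using \<open>b \<in> S\<close> a' by blast
      qed
      then show ?thesis using xa False M(5) a(1) by blast
    qed
  qed
  then show "S \<in> transversals f V" using S(1) by (auto simp: transversals_def)
qed

text \<open>Removing a vertex of degree at most one together with its neighbour (which is put into \<open>A\<close>)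
  leaves a graph of the same kind, so \<open>A\<close> becomes a vertex cover.\<close>

lemma matching_with_cover_exists:
  assumes fin: "finite V" and sym: "sym E" and irr: "irrefl E"
    and deg: "\<And>W. W \<subseteq> V \<Longrightarrow> W \<noteq> {} \<Longrightarrow>
      \<exists>b\<in>W. \<forall>y\<in>W. \<forall>z\<in>W. (b, y) \<in> E \<longrightarrow> (b, z) \<in> E \<longrightarrow> y = z"
  shows "\<exists>f A. matching E f A V \<and> stable_set E (V - A)"
  using fin deg
proof (induction V rule: finite_psubset_induct)
  case (psubset V)
  show ?case
  proof (cases "V = {}")
    case True
    then show ?thesis by (intro exI[of _ id] exI[of _ "{}"]) (simp add: matching_def stable_set_def)
  next
    case False
    then obtain b where b: "b \<in> V" "\<And>y z. y \<in> V \<Longrightarrow> z \<in> V \<Longrightarrow> (b, y) \<in> E \<Longrightarrow> (b, z) \<in> E \<Longrightarrow> y = z"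
      using psubset.prems[of V] by blast
    have bb: "(b, b) \<notin> E" using irr by (auto simp: irrefl_def)
    show ?thesis
    proof (cases "\<exists>a\<in>V. (b, a) \<in> E")
      case False
      obtain f A where fA: "matching E f A (V - {b})" "stable_set E (V - {b} - A)"
        using psubset.IH[of "V - {b}"] psubset.prems b(1) by blast
      note M = matchingD[OF fA(1)]
      \<comment> \<open>The vertex \<open>b\<close> becomes unmatched and stays outside
        \<open>A\<close>, which is harmless as it has no neighbour in \<open>V\<close>.\<close>
      have "matching E (f(b := b)) A V"
        unfolding matching_def
      proof (intro conjI ballI)
        show "A \<subseteq> V" using M(1) by blast
        have bA: "b \<notin> A" using M(1) by blast
        fix x
        { assume "x \<in> V"
          then consider "x = b" | "x \<in> V - {b}" by blast
          note cases = this
          show "(f(b := b)) x \<in> V" using cases by cases (use b(1) M(2) in auto)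
          show "(f(b := b)) ((f(b := b)) x) = x" using cases by cases (use M(2,3) in auto)
          show "(f(b := b)) x \<noteq> x \<longrightarrow> (x \<in> A) = ((f(b := b)) x \<notin> A)"
            using cases by cases (use M(4) in auto)
        }
        assume "x \<in> A"
        then show "(f(b := b)) x \<noteq> x" "(x, (f(b := b)) x) \<in> E" using bA M(5,6) by auto
      qed
      moreover have "stable_set E (V - A)"
        using fA(2) False bb symD[OF sym] unfolding stable_set_def by (metis Diff_iff empty_iff insert_iff)
      ultimately show ?thesis by blast
    next
      case True
      then obtain a where a: "a \<in> V" "(b, a) \<in> E" by blast
      have ab: "a \<noteq> b" "(a, b) \<in> E" using a bb symD[OF sym] by auto
      let ?U = "V - {a, b}"
      obtain f A where fA: "matching E f A ?U" "stable_set E (?U - A)"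
        using psubset.IH[of ?U] psubset.prems b(1) by blast
      note M = matchingD[OF fA(1)]
      have bA: "b \<notin> A" "a \<notin> A" using M(1) by auto
      have "matching E (f(a := b, b := a)) (insert a A) V"
        unfolding matching_def
      proof (intro conjI ballI)
        show "insert a A \<subseteq> V" using M(1) a by blast
        fix x
        { assume "x \<in> V"
          consider "x = a" | "x = b" | "x \<in> ?U" using \<open>x \<in> V\<close> by blast
          note cases = this
          show "(f(a := b, b := a)) x \<in> V" using cases by cases (use a b M(2) in auto)
          show "(f(a := b, b := a)) ((f(a := b, b := a)) x) = x"
            using cases by cases (use ab M(2,3) in auto)
          show "(f(a := b, b := a)) x \<noteq> x \<longrightarrow> (x \<in> insert a A) = ((f(a := b, b := a)) x \<notin> insert a A)"
            using cases by cases (use ab bA M(2,4) in auto)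
        }
        assume x: "x \<in> insert a A"
        show "(f(a := b, b := a)) x \<noteq> x" using x ab bA M(5) by auto
        show "(x, (f(a := b, b := a)) x) \<in> E" using x ab bA M(6) by auto
      qed
      \<comment> \<open>The only neighbour of \<open>b\<close> in \<open>V\<close> is
        \<open>a\<close>, which has joined \<open>A\<close>.\<close>
      moreover have "stable_set E (V - insert a A)"
        unfolding stable_set_def
      proof (intro ballI)
        fix u v assume uv: "u \<in> V - insert a A" "v \<in> V - insert a A"
        show "(u, v) \<notin> E"
          using uv fA(2) b(2)[OF a(1) _ a(2)] symD[OF sym] unfolding stable_set_def
          by (metis Diff_iff empty_iff insert_iff)
      qed
      ultimately show ?thesis by blast
    qed
  qed
qed

text \<open>Pairing consecutive vertices turns a path given by its vertices into a walk given by its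
  arcs, the form in which cycles are defined.\<close>

lemma walk_of_vertex_list:
  assumes "successively (\<lambda>a b. (a, b) \<in> E) (v # xs)"
  shows "pcas v (zip (v # xs) xs) (last (v # xs))"
    and "pawalk_verts v (zip (v # xs) xs) = v # xs"
    and "set (zip (v # xs) xs) \<subseteq> E"
  using assms by (induction xs arbitrary: v) auto

text \<open>Take a longest path inside \<open>W\<close>. If its first vertex had two neighbours in
  \<open>W\<close>, one that is not the second vertex of the path would either prolong the path or
  close a cycle.\<close>

lemma (in pair_graph) vertex_of_degree_le_1_exists:
  assumes acyc: "\<not> (\<exists>p. cycle p \<and> 3 \<le> length p)" and W: "W \<subseteq> pverts G" "W \<noteq> {}"
  shows "\<exists>b\<in>W. \<forall>y\<in>W. \<forall>z\<in>W. (b, y) \<in> parcs G \<longrightarrow> (b, z) \<in> parcs G \<longrightarrow> y = z"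
proof (rule ccontr)
  assume neg: "\<not> ?thesis"
  let ?path = "\<lambda>xs. xs \<noteq> [] \<and> distinct xs \<and> set xs \<subseteq> W \<and> successively (\<lambda>a b. (a, b) \<in> parcs G) xs"
  have finW: "finite W" using W(1) pair_finite_verts finite_subset by blast
  obtain w where "w \<in> W" using W(2) by blast
  then have "?path [w]" by simp
  moreover have "\<forall>xs. ?path xs \<longrightarrow> length xs < Suc (card W)"
    using card_mono[OF finW] distinct_card by (metis less_Suc_eq_le)
  ultimately obtain xs where xs: "?path xs" and max: "\<And>ys. ?path ys \<Longrightarrow> length ys \<le> length xs"
    using ex_has_greatest_nat[of ?path "[w]" length "Suc (card W)"] by blast
  obtain v rest where v: "xs = v # rest" using xs by (cases xs) auto
  have "v \<in> W" using xs v by simp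
  then obtain y z where "y \<in> W" "z \<in> W" "(v, y) \<in> parcs G" "(v, z) \<in> parcs G" "y \<noteq> z"
    using neg by blast
  then obtain z where z: "z \<in> W" "(v, z) \<in> parcs G" "rest \<noteq> [] \<longrightarrow> z \<noteq> hd rest"
    by (cases "y = hd rest") auto
  have zv: "(z, v) \<in> parcs G" using z(2) arcs_symmetric by blast
  have "z \<noteq> v" using z(2) pair_no_loops by force
  have "z \<in> set xs"
  proof (rule ccontr)
    assume "z \<notin> set xs"
    then have "?path (z # xs)" using xs z zv v by (auto simp: successively_Cons)
    then show False using max by fastforce
  qed
  then obtain ys zs where rest: "rest = ys @ z # zs"
    using \<open>z \<noteq> v\<close> v by (metis set_ConsD split_list)
  then have "ys \<noteq> []" using z(3) by auto
  \<comment> \<open>The cycle follows the path from \<open>v\<close> to \<open>z\<close> and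
    returns. As \<open>z\<close> is not the second vertex, \<open>ys\<close> is nonempty and the
    cycle has at least three arcs.\<close>
  let ?ys = "ys @ [z, v]"
  have succ: "successively (\<lambda>a b. (a, b) \<in> parcs G) (v # ?ys)"
    using xs zv \<open>ys \<noteq> []\<close> unfolding v rest
    by (auto simp: successively_Cons successively_append_iff hd_append)
  note w = walk_of_vertex_list[OF succ]
  have "awalk v (zip (v # ?ys) ?ys) v"
    using w(1,3) \<open>v \<in> W\<close> W(1) unfolding awalk_def by auto
  then have "cycle (zip (v # ?ys) ?ys)"
    unfolding cycle_def using w(2) xs unfolding v rest by (intro exI[of _ v]) auto
  moreover have "3 \<le> length (zip (v # ?ys) ?ys)" using \<open>ys \<noteq> []\<close> by (cases ys) auto
  ultimately show False using acyc by blast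
qed

text \<open>A walk from \<open>W\<close> to a vertex outside must use an arc leaving
  \<open>W\<close>. The symmetric closure in the definition of connectivity adds no arc to a
  symmetric graph.\<close>

lemma (in pair_graph) connected_leaving_arc:
  assumes conn: "Digraph_Component.connected (with_proj G)" and W: "W \<subset> pverts G" "W \<noteq> {}"
  shows "\<exists>c\<in>W. \<exists>x\<in>pverts G - W. (c, x) \<in> parcs G"
proof (rule ccontr)
  assume neg: "\<not> ?thesis"
  obtain u v where uv: "u \<in> W" "v \<in> pverts G" "v \<notin> W" using W by blast
  have "parcs (mk_symmetric (with_proj G)) \<subseteq> parcs G"
    using arcs_symmetric by (auto simp: parcs_mk_symmetric)
  moreover have "u \<rightarrow>\<^sup>*\<^bsub>mk_symmetric (with_proj G)\<^esub> v"
    using conn uv W(1) by (auto simp: Digraph_Component.connected_def strongly_connected_def)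
  ultimately have "(u, v) \<in> (parcs G)\<^sup>*"
    using reachable_rtranclI rtrancl_mono by (metis subsetD with_proj_simps(3))
  then have "v \<in> W"
    by (induction rule: rtrancl_induct) (use uv neg in_arcsD2 in blast)+
  then show False using uv by blast
qed

section \<open>Subdivided stars\<close>

text \<open>The star with centre \<open>c\<close> and leaves \<open>L\<close> whose edges to the vertices \<open>x \<in> D\<close> are subdivided
  by \<open>h x\<close>.\<close>

definition spider :: "'a pair_pre_digraph \<Rightarrow> 'a \<Rightarrow> 'a set \<Rightarrow> 'a set \<Rightarrow> ('a \<Rightarrow> 'a) \<Rightarrow> bool" where
  "spider T c L D h \<longleftrightarrow> finite L \<and> c \<notin> L \<and> D \<subseteq> L \<and> inj_on h D \<and> h ` D \<inter> insert c L = {} \<and>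
     pverts T = insert c L \<union> h ` D \<and>
     (\<forall>u v. (u, v) \<in> parcs T \<longleftrightarrow>
       u = c \<and> (v \<in> L - D \<or> v \<in> h ` D) \<or> v = c \<and> (u \<in> L - D \<or> u \<in> h ` D) \<or>
       v \<in> D \<and> u = h v \<or> u \<in> D \<and> v = h u)"

text \<open>Every edge of the star contains the centre, so \<open>F\<close> is identified with the
  set \<open>D\<close> of the other ends, and \<open>h\<close> indexes the new vertices by these
  leaves.\<close>

lemma spider_if_arises_by_subdividing_star:
  assumes S: "complete_bipartite_digraph 1 \<alpha> (with_proj S)" and T: "arises_by_subdividing m S T"
  shows "\<exists>c L D h. spider T c L D h \<and> card L = \<alpha> \<and> card D = m"
proof -
  obtain U L where UL: "finite (pverts S)" "pverts S = U \<union> L" "U \<inter> L = {}" "card U = 1" "card L = \<alpha>"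
    "parcs S = U \<times> L \<union> L \<times> U"
    using S unfolding complete_bipartite_digraph_pair_def by blast
  obtain c where U: "U = {c}" using UL(4) card_1_singletonE by blast
  have cL: "c \<notin> L" using UL(3) U by blast
  obtain F w where F: "F \<subseteq> edges S" "card F = m" "inj_on w F" "w ` F \<inter> pverts S = {}"
    "T = subdivide_edges S F w"
    using T unfolding arises_by_subdividing_def by blast
  have arc: "(u, v) \<in> parcs S \<longleftrightarrow> u = c \<and> v \<in> L \<or> v = c \<and> u \<in> L" for u v
    using UL(6) U by auto
  define D where "D = {x \<in> L. {c, x} \<in> F}"
  define h where "h x = w {c, x}" for x
  have FD: "F = (\<lambda>x. {c, x}) ` D"
  proof
    show "F \<subseteq> (\<lambda>x. {c, x}) ` D"
    proof
      fix e assume e: "e \<in> F"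
      then obtain u v where "e = {u, v}" "(u, v) \<in> parcs S" using F(1) by (auto simp: edges_def)
      then show "e \<in> (\<lambda>x. {c, x}) ` D" using e unfolding D_def arc by (auto simp: insert_commute)
    qed
  qed (auto simp: D_def)
  have inj: "inj_on (\<lambda>x. {c, x}) D" using cL by (auto simp: inj_on_def doubleton_eq_iff)
  have hD: "h ` D = w ` F" unfolding FD h_def by blast
  have inF: "{u, v} \<in> F \<longleftrightarrow> u = c \<and> v \<in> D \<or> v = c \<and> u \<in> D" for u v
    unfolding FD by (auto simp: doubleton_eq_iff)
  have parcs: "parcs T = {(u, v). (u, v) \<in> parcs S \<and> {u, v} \<notin> F}
             \<union> {(u, w {u, v}) | u v. (u, v) \<in> parcs S \<and> {u, v} \<in> F}
             \<union> {(w {u, v}, u) | u v. (u, v) \<in> parcs S \<and> {u, v} \<in> F}"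
    unfolding F(5) subdivide_edges_def by simp
  have DL: "D \<subseteq> L" by (auto simp: D_def)
  \<comment> \<open>The orientation starting at \<open>c\<close> contributes the first image and the
    one starting at the leaf the second.\<close>
  have A: "{(u, w {u, v}) | u v. (u, v) \<in> parcs S \<and> {u, v} \<in> F}
      = (\<lambda>x. (c, h x)) ` D \<union> (\<lambda>x. (x, h x)) ` D"
    unfolding arc inF h_def using DL cL by (auto simp: insert_commute) blast+
  have B: "{(w {u, v}, u) | u v. (u, v) \<in> parcs S \<and> {u, v} \<in> F}
      = (\<lambda>x. (h x, c)) ` D \<union> (\<lambda>x. (h x, x)) ` D"
    unfolding arc inF h_def using DL cL by (auto simp: insert_commute) blast+
  have "spider T c L D h"
    unfolding spider_def
  proof (intro conjI allI)
    show "finite L" using UL(1,2) by auto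
    show "inj_on h D"
      using comp_inj_on[OF inj, of w] F(3) unfolding FD h_def comp_def by blast
    show "h ` D \<inter> insert c L = {}" using F(4) UL(2) U unfolding hD by blast
    show "pverts T = insert c L \<union> h ` D"
      unfolding hD F(5) using UL(2) U by (simp add: subdivide_edges_def)
    fix u v
    show "(u, v) \<in> parcs T \<longleftrightarrow>
       u = c \<and> (v \<in> L - D \<or> v \<in> h ` D) \<or> v = c \<and> (u \<in> L - D \<or> u \<in> h ` D) \<or>
       v \<in> D \<and> u = h v \<or> u \<in> D \<and> v = h u"
      unfolding parcs A B
      unfolding Un_iff mem_Collect_eq case_prod_conv arc inF image_iff Pair_inject
      using DL cL by blast
  qed (use cL DL in auto)
  moreover have "card D = m" using F(2) card_image[OF inj] unfolding FD by simp
  ultimately show ?thesis using UL(5) by blast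
qed

text \<open>Replacing each path \<open>c\<close>, \<open>h x\<close>, \<open>x\<close> by the edge
  from \<open>c\<close> to \<open>x\<close> recovers the star.\<close>

lemma arises_by_subdividing_star_if_spider:
  assumes sp: "spider T c L D h"
  shows "\<exists>S. complete_bipartite_digraph 1 (card L) (with_proj S) \<and> arises_by_subdividing (card D) S T"
proof -
  have cL: "c \<notin> L" and DL: "D \<subseteq> L" and finL: "finite L" and injh: "inj_on h D"
    and dis: "h ` D \<inter> insert c L = {}" and pv: "pverts T = insert c L \<union> h ` D"
    and pa: "\<And>u v. (u, v) \<in> parcs T \<longleftrightarrow>
       u = c \<and> (v \<in> L - D \<or> v \<in> h ` D) \<or> v = c \<and> (u \<in> L - D \<or> u \<in> h ` D) \<or>
       v \<in> D \<and> u = h v \<or> u \<in> D \<and> v = h u"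
    using sp unfolding spider_def by blast+
  have cD: "c \<notin> D" using cL DL by blast
  define S where "S = \<lparr> pverts = insert c L, parcs = {c} \<times> L \<union> L \<times> {c} \<rparr>"
  define F where "F = (\<lambda>x. {c, x}) ` D"
  \<comment> \<open>Removing \<open>c\<close> from an edge recovers its leaf, the argument of
    \<open>h\<close>.\<close>
  define w where "w e = h (the_elem (e - {c}))" for e
  have wh: "w {c, x} = h x" "w {x, c} = h x" if "x \<in> D" for x
  proof -
    have "{c, x} - {c} = {x}" "{x, c} - {c} = {x}" using that cD by auto
    then show "w {c, x} = h x" "w {x, c} = h x" by (simp_all add: w_def)
  qed
  have inj: "inj_on (\<lambda>x. {c, x}) D" using cD by (auto simp: inj_on_def doubleton_eq_iff)
  have wF: "w ` F = h ` D" unfolding F_def image_image using wh by (intro image_cong) auto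
  have arc: "(u, v) \<in> parcs S \<longleftrightarrow> u = c \<and> v \<in> L \<or> v = c \<and> u \<in> L" for u v
    by (auto simp: S_def)
  have inF: "{u, v} \<in> F \<longleftrightarrow> u = c \<and> v \<in> D \<or> v = c \<and> u \<in> D" for u v
    unfolding F_def by (auto simp: doubleton_eq_iff)
  have A: "{(u, w {u, v}) | u v. (u, v) \<in> parcs S \<and> {u, v} \<in> F}
      = (\<lambda>x. (c, h x)) ` D \<union> (\<lambda>x. (x, h x)) ` D"
  proof -
    have "{(u, w {u, v}) | u v. (u, v) \<in> parcs S \<and> {u, v} \<in> F}
      = (\<lambda>x. (c, w {c, x})) ` D \<union> (\<lambda>x. (x, w {x, c})) ` D"
      unfolding arc inF using DL cL by blast
    then show ?thesis by (simp add: wh cong: image_cong)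
  qed
  have B: "{(w {u, v}, u) | u v. (u, v) \<in> parcs S \<and> {u, v} \<in> F}
      = (\<lambda>x. (h x, c)) ` D \<union> (\<lambda>x. (h x, x)) ` D"
  proof -
    have "{(w {u, v}, u) | u v. (u, v) \<in> parcs S \<and> {u, v} \<in> F}
      = (\<lambda>x. (w {c, x}, c)) ` D \<union> (\<lambda>x. (w {x, c}, x)) ` D"
      unfolding arc inF using DL cL by blast
    then show ?thesis by (simp add: wh cong: image_cong)
  qed
  have "parcs T = parcs (subdivide_edges S F w)"
  proof (intro set_eqI, clarify)
    fix u v
    show "(u, v) \<in> parcs T \<longleftrightarrow> (u, v) \<in> parcs (subdivide_edges S F w)"
      unfolding subdivide_edges_def pair_pre_digraph.simps A B
      unfolding Un_iff mem_Collect_eq case_prod_conv arc inF image_iff Pair_inject pa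
      using DL cL by blast
  qed
  moreover have "pverts T = pverts (subdivide_edges S F w)"
    unfolding subdivide_edges_def pair_pre_digraph.simps wF pv by (simp add: S_def)
  ultimately have "T = subdivide_edges S F w" by simp
  moreover have "F \<subseteq> edges S" using DL unfolding F_def edges_def arc by blast
  moreover have "finite F" using DL finL finite_subset unfolding F_def by blast
  moreover have "card F = card D" unfolding F_def using inj by (rule card_image)
  moreover have "inj_on w F"
    unfolding F_def using injh wh cD by (auto simp: inj_on_def)
  moreover have "w ` F \<inter> pverts S = {}" using dis unfolding wF by (simp add: S_def)
  ultimately have "arises_by_subdividing (card D) S T"
    unfolding arises_by_subdividing_def by blast
  moreover have "complete_bipartite_digraph 1 (card L) (with_proj S)"
    unfolding complete_bipartite_digraph_pair_def
    by (intro conjI exI[of _ "{c}"] exI[of _ L]) (use finL cL in \<open>auto simp: S_def\<close>)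
  ultimately show ?thesis by blast
qed

text \<open>The independent sets counted here are \<open>L\<close> with some vertices of \<open>D\<close> replaced by their
  neighbours, and \<open>{c} \<union> D\<close>.\<close>

lemma card_independent_sets_spider_ge:
  assumes sp: "spider T c L D h"
  shows "2 ^ card D + (if card L = card D + 1 then 1 else 0)
    \<le> card {S \<in> independent_sets T. card S = card L}"
proof -
  have cL: "c \<notin> L" and DL: "D \<subseteq> L" and finL: "finite L" and injh: "inj_on h D"
    and dis: "h ` D \<inter> insert c L = {}" and pv: "pverts T = insert c L \<union> h ` D"
    and pa: "\<And>u v. (u, v) \<in> parcs T \<longleftrightarrow>
       u = c \<and> (v \<in> L - D \<or> v \<in> h ` D) \<or> v = c \<and> (u \<in> L - D \<or> u \<in> h ` D) \<or>
       v \<in> D \<and> u = h v \<or> u \<in> D \<and> v = h u"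
    using sp unfolding spider_def by blast+
  let ?M = "{S \<in> independent_sets T. card S = card L}"
  let ?g = "\<lambda>X. (L - X) \<union> h ` X"
  have finD: "finite D" using DL finL finite_subset by blast
  have cD: "c \<notin> D" using cL DL by blast
  have "finite (independent_sets T)"
    by (rule finite_subset[of _ "Pow (pverts T)"]) (auto simp: independent_sets_def pv finL finD)
  then have finM: "finite ?M" by simp
  have gM: "?g X \<in> ?M" if X: "X \<subseteq> D" for X
  proof -
    have finX: "finite X" using X finD finite_subset by blast
    have "card (?g X) = card (L - X) + card (h ` X)"
      by (rule card_Un_disjoint) (use finL finX dis X in auto)
    also have "card (h ` X) = card X" using card_image inj_on_subset[OF injh X] by blast
    also have "card (L - X) + card X = card L"
      using X DL finL finX by (metis card_Diff_subset card_mono le_add_diff_inverse2 subset_trans)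
    finally have "card (?g X) = card L" .
    moreover have "?g X \<in> independent_sets T"
      unfolding independent_sets_def
    proof (intro CollectI conjI ballI)
      show "?g X \<subseteq> pverts T" using pv X by blast
      have ch: "h x = h y \<longleftrightarrow> x = y" if "x \<in> D" "y \<in> D" for x y
        using injh that by (auto simp: inj_on_def)
      have hX: "h x \<notin> h ` X" if "x \<in> D" "x \<notin> X" for x
        using ch X that by blast
      have hL: "h x \<notin> L" "h x \<noteq> c" if "x \<in> D" for x using dis that by blast+
      fix u v assume "u \<in> ?g X" "v \<in> ?g X"
      moreover have "c \<notin> ?g X" using cL hL X by blast
      ultimately show "(u, v) \<notin> parcs T"
        unfolding pa using hX hL X DL by blast
    qed
    ultimately show ?thesis by blast
  qed
  have inj: "inj_on ?g (Pow D)"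
  proof (rule inj_onI)
    fix X Y assume "X \<in> Pow D" "Y \<in> Pow D" "?g X = ?g Y"
    moreover have "X = D - ?g X" if "X \<in> Pow D" for X
      using that DL dis by blast
    ultimately show "X = Y" by metis
  qed
  have cg: "card (?g ` Pow D) = 2 ^ card D"
    using card_image[OF inj] finD by (simp add: card_Pow)
  show ?thesis
  proof (cases "card L = card D + 1")
    case False
    have "card (?g ` Pow D) \<le> card ?M" by (rule card_mono[OF finM]) (use gM in blast)
    then show ?thesis using False cg by simp
  next
    case True
    \<comment> \<open>In this case the set has the right size, and it is new because it contains
      \<open>c\<close>.\<close>
    have "insert c D \<in> independent_sets T"
      unfolding independent_sets_def
    proof (intro CollectI conjI ballI)
      show "insert c D \<subseteq> pverts T" using pv DL by blast
      fix u v assume "u \<in> insert c D" "v \<in> insert c D"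
      then show "(u, v) \<notin> parcs T" unfolding pa using cL DL dis by blast
    qed
    moreover have "card (insert c D) = card L" using True finD cD by simp
    ultimately have "insert c D \<in> ?M" by blast
    moreover have "insert c D \<notin> ?g ` Pow D" using cL DL dis by blast
    ultimately have "card (insert (insert c D) (?g ` Pow D)) \<le> card ?M"
      by (intro card_mono[OF finM]) (use gM in blast)
    then show ?thesis using \<open>insert c D \<notin> ?g ` Pow D\<close> cg True finD by simp
  qed
qed

text \<open>A vertex other than \<open>c\<close> that is not adjacent to \<open>c\<close> has its
  partner as only neighbour, and by connectivity the partner is adjacent to \<open>c\<close>. As
  there are no triangles, each matching edge not containing \<open>c\<close> has such an end; these
  ends form \<open>D\<close>.\<close>

lemma (in pair_graph) spider_if_edges_at_centre:
  assumes m: "matching (parcs G) f A (pverts G)"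
    and conn: "\<And>W. W \<subset> pverts G \<Longrightarrow> W \<noteq> {} \<Longrightarrow> \<exists>c\<in>W. \<exists>x\<in>pverts G - W. (c, x) \<in> parcs G"
    and triangle_free: "\<And>x y z. (x, y) \<in> parcs G \<Longrightarrow> (y, z) \<in> parcs G \<Longrightarrow> (x, z) \<notin> parcs G"
    and c: "c \<in> pverts G" "f c \<noteq> c"
    and edges: "\<And>y z. (y, z) \<in> parcs G \<Longrightarrow> y \<noteq> c \<Longrightarrow> z \<noteq> c \<Longrightarrow> z = f y"
  shows "\<exists>L D h. spider G c L D h \<and> card D = card A - 1 \<and> card L + card A = card (pverts G)"
proof -
  let ?V = "pverts G" and ?E = "parcs G"
  note M = matchingD[OF m]
  have symE: "(u, v) \<in> ?E \<longleftrightarrow> (v, u) \<in> ?E" for u v using arcs_symmetric by blast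
  have sym: "sym ?E" using symE by (auto simp: sym_def)
  have irr: "(u, u) \<notin> ?E" for u using pair_no_loops by force
  have VE: "u \<in> ?V" "v \<in> ?V" if "(u, v) \<in> ?E" for u v
    using that wellformed' by blast+
  have finV: "finite ?V" by (rule pair_finite_verts)
  have finA: "finite A" using M(1) finV finite_subset by blast
  note me = matched_edge[OF m sym]
  define D where "D = {y \<in> ?V. y \<noteq> c \<and> (c, y) \<notin> ?E}"
  have Dy: "f y \<noteq> y" "f y \<noteq> c" "(c, f y) \<in> ?E" if y: "y \<in> D" for y
  proof -
    have yV: "y \<in> ?V" "y \<noteq> c" "(y, c) \<notin> ?E" using y symE by (auto simp: D_def)
    have "{y} \<subset> ?V" using yV c by auto
    then obtain x where "(y, x) \<in> ?E" "x \<noteq> y" using conn[of "{y}"] by blast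
    then show ny: "f y \<noteq> y" using edges yV by blast
    show nc: "f y \<noteq> c" using me[OF yV(1) ny] yV by metis
    \<comment> \<open>An arc leaving this pair is not a matching edge, so it ends at
      \<open>c\<close>; it cannot start at \<open>y\<close>, which is not adjacent to
      \<open>c\<close>.\<close>
    have "{y, f y} \<subset> ?V" using yV(1,2) c(1) nc M(2)[OF yV(1)] by auto
    then obtain u x where ux: "u \<in> {y, f y}" "x \<notin> {y, f y}" "(u, x) \<in> ?E"
      using conn[of "{y, f y}"] by blast
    have "x = c" using ux edges[OF ux(3)] yV nc M(3) by auto
    then show "(c, f y) \<in> ?E" using ux yV symE by blast
  qed
  have adj: "(c, y) \<in> ?E" if "y \<in> ?V" "y \<noteq> c" "y \<notin> D" for y
    using that by (simp add: D_def)
  have fD: "f y \<notin> D" "f y \<in> ?V" "f (f y) = y" "y \<in> ?V" "y \<noteq> c" if "y \<in> D" for y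
    using Dy[OF that] that M(2,3) by (auto simp: D_def)
  have cD: "c \<notin> D" by (simp add: D_def)
  have out: "a \<in> D \<or> f a \<in> D" if a: "a \<in> ?V" "f a \<noteq> a" "a \<noteq> c" "f a \<noteq> c" for a
  proof (rule ccontr)
    assume "\<not> ?thesis"
    then have "(c, a) \<in> ?E" "(c, f a) \<in> ?E" using adj a M(2) by blast+
    moreover have "(a, f a) \<in> ?E" using me a by blast
    ultimately show False using triangle_free by blast
  qed
  let ?B = "A - {c, f c}"
  have cfc: "f c \<in> ?V" "f (f c) = c" using c M(2,3) by blast+
  have fcD: "f c \<notin> D" using me[OF c] by (simp add: D_def)
  \<comment> \<open>The end in \<open>A\<close> of the pair of \<open>y\<close>: a bijection from
    \<open>D\<close> onto \<open>A\<close> without the pair of \<open>c\<close>.\<close>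
  define p where "p y = (if y \<in> A then y else f y)" for y
  have injp: "inj_on p D"
    by (rule inj_onI) (use fD in \<open>metis p_def\<close>)
  have imp: "p ` D = ?B"
  proof
    show "p ` D \<subseteq> ?B"
    proof
      fix a assume "a \<in> p ` D"
      then obtain y where y: "y \<in> D" "a = p y" by blast
      have "a \<in> A" using y fD[OF y(1)] Dy[OF y(1)] M(4)[of y] by (auto simp: p_def)
      moreover have "a \<noteq> c" using y fD[OF y(1)] Dy[OF y(1)] by (auto simp: p_def)
      moreover have "a \<noteq> f c"
        using y fD[OF y(1)] fcD cfc unfolding p_def by metis
      ultimately show "a \<in> ?B" by blast
    qed
    show "?B \<subseteq> p ` D"
    proof
      fix a assume a: "a \<in> ?B"
      then have aV: "a \<in> ?V" "f a \<noteq> a" "f a \<noteq> c" using M(1,3,5) by auto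
      have fa: "f a \<notin> A" "f (f a) = a" using M(3,4) aV a by blast+
      have "a \<in> D \<or> f a \<in> D" using out aV a by blast
      moreover have "p a = a" "p (f a) = a" using a fa by (auto simp: p_def)
      ultimately show "a \<in> p ` D" by (metis imageI)
    qed
  qed
  have "c \<in> A \<and> f c \<notin> A \<or> c \<notin> A \<and> f c \<in> A" using M(4)[OF c] by blast
  then have "?B = A - {c} \<and> c \<in> A \<or> ?B = A - {f c} \<and> f c \<in> A" by blast
  then have B: "card ?B = card A - 1" "card A \<ge> 1"
    using finA by (metis card_Diff_singleton, metis One_nat_def Suc_leI card_gt_0_iff empty_iff)
  have cardD: "card D = card A - 1" using card_image[OF injp] imp B by simp
  have injf: "inj_on f D" using fD by (metis inj_onI)
  \<comment> \<open>Besides \<open>D\<close> this contains \<open>f c\<close> and the unmatched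
    vertices, which are the leaves on unsubdivided edges.\<close>
  define L where "L = ?V - insert c (f ` D)"
  have "card (insert c (f ` D)) = card D + 1"
    using card_image[OF injf] Dy(2) finV by (subst card_insert_disjoint) (auto simp: D_def)
  moreover have "insert c (f ` D) \<subseteq> ?V" using c fD(2) by blast
  ultimately have cardL: "card L + (card D + 1) = card ?V"
    unfolding L_def using finV by (metis card_Diff_subset card_mono finite_subset le_add_diff_inverse2)
  have "spider G c L D f"
    unfolding spider_def
  proof (intro conjI allI)
    show "finite L" using finV by (simp add: L_def)
    show "c \<notin> L" by (simp add: L_def)
    show DL: "D \<subseteq> L" using fD cD by (auto simp: L_def)
    show "inj_on f D" by (rule injf)
    show "f ` D \<inter> insert c L = {}" using Dy(2) by (auto simp: L_def)
    show "?V = insert c L \<union> f ` D" using c fD(2) by (auto simp: L_def)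
    fix u v
    show "(u, v) \<in> ?E \<longleftrightarrow>
       u = c \<and> (v \<in> L - D \<or> v \<in> f ` D) \<or> v = c \<and> (u \<in> L - D \<or> u \<in> f ` D) \<or>
       v \<in> D \<and> u = f v \<or> u \<in> D \<and> v = f u" (is "_ \<longleftrightarrow> ?R")
    proof
      assume e: "(u, v) \<in> ?E"
      have nbr: "w \<in> L - D \<or> w \<in> f ` D" if "(c, w) \<in> ?E" for w
        using that irr VE(2)[OF that] by (auto simp: L_def D_def)
      show ?R
      proof (cases "u = c \<or> v = c")
        case True
        then show ?thesis using nbr e symE by blast
      next
        case False
        then have uv: "v = f u" using edges e by blast
        then have "u \<in> D \<or> v \<in> D" using out[of u] False e irr VE(1)[OF e] by metis
        then show ?thesis using uv M(3) VE(1)[OF e] by metis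
      qed
    next
      have 1: "(c, w) \<in> ?E" if "w \<in> L - D \<or> w \<in> f ` D" for w
        using that Dy(3) adj by (auto simp: L_def)
      have 2: "(w, f w) \<in> ?E" if "w \<in> D" for w
        using me fD(4) Dy(1) that by blast
      assume ?R
      then show "(u, v) \<in> ?E" using 1 2 symE by blast
    qed
  qed
  then show ?thesis using cardD cardL B(2) by (intro exI conjI) auto
qed

section \<open>Maximum independent sets of trees\<close>

text \<open>The second branch means \<open>2 * \<alpha> > n\<close>, since a tree never has
  \<open>2 * \<alpha> < n\<close>. A single vertex is excluded: truncated subtraction would make the
  bound 1 and attained, while a star with one edge already has two vertices.\<close>

theorem theorem3:
  fixes T :: "'a pair_pre_digraph" and n \<alpha> :: nat
  assumes "undirected_tree T"
    and "card (pverts T) = n"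
    and "independence_number T = \<alpha>"
    and "n \<ge> 2"
  shows "num_max_independent_sets T \<le> (if 2 * \<alpha> = n then 2 ^ (n - \<alpha> - 1) + 1 else 2 ^ (n - \<alpha> - 1)) \<and>
    (num_max_independent_sets T = (if 2 * \<alpha> = n then 2 ^ (n - \<alpha> - 1) + 1 else 2 ^ (n - \<alpha> - 1)) \<longleftrightarrow>
       (\<exists>S :: 'a pair_pre_digraph. complete_bipartite_digraph 1 \<alpha> (with_proj S) \<and>
          arises_by_subdividing (n - \<alpha> - 1) S T))"
proof -
  interpret pair_graph T using assms(1) by (simp add: undirected_tree_def)
  let ?V = "pverts T" and ?E = "parcs T"
  let ?bound = "if 2 * \<alpha> = n then 2 ^ (n - \<alpha> - 1) + 1 else 2 ^ (n - \<alpha> - 1) :: nat"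
  have finV: "finite ?V" by (rule pair_finite_verts)
  have symE: "(u, v) \<in> ?E \<Longrightarrow> (v, u) \<in> ?E" for u v using arcs_symmetric by blast
  have sym: "sym ?E" using symE by (auto simp: sym_def)
  have irr: "irrefl ?E" using pair_no_loops by (force simp: irrefl_def)
  have deg: "\<exists>b\<in>W. \<forall>y\<in>W. \<forall>z\<in>W. (b, y) \<in> ?E \<longrightarrow> (b, z) \<in> ?E \<longrightarrow> y = z" if "W \<subseteq> ?V" "W \<noteq> {}" for W
    using vertex_of_degree_le_1_exists that assms(1) unfolding undirected_tree_def by blast
  have conn: "\<exists>c\<in>W. \<exists>x\<in>?V - W. (c, x) \<in> ?E" if "W \<subset> ?V" "W \<noteq> {}" for W
    using connected_leaving_arc that assms(1) unfolding undirected_tree_def by blast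
  have triangle_free: "(x, z) \<notin> ?E" if xy: "(x, y) \<in> ?E" and yz: "(y, z) \<in> ?E" for x y z
  proof
    assume xz: "(x, z) \<in> ?E"
    have ne: "x \<noteq> y" "y \<noteq> z" "x \<noteq> z" using xy yz xz irr by (auto simp: irrefl_def)
    \<comment> \<open>No vertex of a triangle has at most one neighbour among its vertices.\<close>
    have "{x, y, z} \<subseteq> ?V" using xy yz wellformed' by blast
    then obtain b where b: "b \<in> {x, y, z}"
      "\<And>v w. v \<in> {x, y, z} \<Longrightarrow> w \<in> {x, y, z} \<Longrightarrow> (b, v) \<in> ?E \<Longrightarrow> (b, w) \<in> ?E \<Longrightarrow> v = w"
      using deg[of "{x, y, z}"] by blast
    then consider "b = x" | "b = y" | "b = z" by blast
    then show False
    proof cases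
      case 1
      then show False using b(2)[of y z] xy xz ne by blast
    next
      case 2
      then show False using b(2)[of x z] symE[OF xy] yz ne by blast
    next
      case 3
      then show False using b(2)[of x y] symE[OF xz] symE[OF yz] ne by blast
    qed
  qed
  obtain f A where m: "matching ?E f A ?V" and cover: "stable_set ?E (?V - A)"
    using matching_with_cover_exists[OF finV sym irr deg] by blast
  note M = matchingD[OF m]
  have ind: "independent_sets T = {S. S \<subseteq> ?V \<and> stable_set ?E S}"
    by (auto simp: independent_sets_def stable_set_def)
  have fin_ind: "finite (independent_sets T)"
    by (rule finite_subset[of _ "Pow ?V"]) (auto simp: ind finV)
  have cardA: "card A \<le> n" using card_mono[OF finV M(1)] assms(2) by simp
  \<comment> \<open>The matching bounds every independent set, and the complement of the vertex
    cover \<open>A\<close> attains the bound, as in Koenig's theorem.\<close>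
  have \<alpha>: "\<alpha> = n - card A"
    unfolding assms(3)[symmetric] independence_number_def
  proof (rule Max_eqI)
    show "finite (card ` independent_sets T)" using fin_ind by simp
    show "k \<le> n - card A" if k: "k \<in> card ` independent_sets T" for k
    proof -
      obtain S where "k = card S" "S \<in> independent_sets T" using k by (rule imageE)
      then show ?thesis
        using stable_set_matching_bound(1)[OF m finV sym, of S] assms(2) by (simp add: ind)
    qed
    have "card (?V - A) = n - card A"
      using card_Diff_subset[OF _ M(1)] finite_subset[OF M(1) finV] assms(2) by simp
    then show "n - card A \<in> card ` independent_sets T"
      using cover unfolding ind by (intro image_eqI[of _ _ "?V - A"]) auto
  qed
  then have \<mu>: "n - \<alpha> = card A" "\<alpha> + card A = n" using cardA by simp_all
  let ?I = "indep_transversals ?E f ?V"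
  \<comment> \<open>Maximum independent sets are the equality case of the matching bound.\<close>
  have sub: "{S \<in> independent_sets T. card S = \<alpha>} \<subseteq> ?I"
  proof
    fix S assume "S \<in> {S \<in> independent_sets T. card S = \<alpha>}"
    then have "S \<subseteq> ?V" "stable_set ?E S" "card S + card A = card ?V"
      using \<mu>(2) assms(2) unfolding ind by simp_all
    then show "S \<in> ?I"
      using stable_set_matching_bound(2)[OF m finV sym] by (simp add: indep_transversals_def)
  qed
  then have numI: "num_max_independent_sets T \<le> card ?I"
    unfolding num_max_independent_sets_def assms(3)
    by (rule card_mono[OF finite_indep_transversals[OF finV]])
  have ffA: "f (f a) = a" if "a \<in> A" for a using M(1,3) that by blast
  have "inj_on f A" by (rule inj_on_inverseI[of _ f]) (rule ffA)
  then have fA: "card (f ` A) = card A" "A \<inter> f ` A = {}" "A \<union> f ` A \<subseteq> ?V"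
    using M(1,2,4,5) by (simp add: card_image, blast, blast)
  have finA: "finite A" using M(1) finV finite_subset by blast
  \<comment> \<open>This counts the matched vertices, so the matching is perfect exactly when
    \<open>2 * \<alpha> = n\<close>.\<close>
  have cardAf: "card (A \<union> f ` A) = 2 * card A"
    using fA card_Un_disjoint[of A "f ` A"] finA by auto
  have fixed: "f v = v \<longleftrightarrow> v \<notin> A \<union> f ` A" if "v \<in> ?V" for v
  proof
    assume v: "f v = v"
    have "v \<noteq> f a" if "a \<in> A" for a using v ffA[OF that] M(5)[OF that] by metis
    then show "v \<notin> A \<union> f ` A" using v M(5) by blast
  next
    assume "v \<notin> A \<union> f ` A"
    then show "f v = v" using that M(3,4)[OF that] by (metis UnCI imageI)
  qed
  have ne: "?V \<noteq> {}" using assms(2,4) by auto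
  have nbr: "\<exists>x\<in>?V. (v, x) \<in> ?E" if v: "v \<in> ?V" for v
  proof -
    have "{v} \<noteq> ?V"
    proof
      assume "{v} = ?V"
      then have "card ?V = 1" using is_singletonI is_singleton_altdef by metis
      then show False using assms(2,4) by simp
    qed
    then have "{v} \<subset> ?V" using v by blast
    then show ?thesis using conn[of "{v}"] by blast
  qed
  have main: "card ?I \<le> ?bound \<and> (card ?I = ?bound \<longrightarrow>
    (\<exists>c\<in>?V. f c \<noteq> c \<and> (\<forall>y\<in>?V. \<forall>z\<in>?V. (y, z) \<in> ?E \<longrightarrow> y \<noteq> c \<longrightarrow> z \<noteq> c \<longrightarrow> z = f y)))"
  proof (cases "2 * \<alpha> = n")
    case True
    then have "card (A \<union> f ` A) = card ?V" using cardAf \<mu> assms(2) by simp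
    then have "A \<union> f ` A = ?V" using card_subset_eq[OF finV fA(3)] by blast
    then have nofix: "f v \<noteq> v" if "v \<in> ?V" for v using fixed that by blast
    have bound: "?bound = 2 ^ (card A - 1) + 1" using True \<mu>(1) by simp
    show ?thesis
      unfolding bound using card_indep_transversals_perfect[OF m finV irr ne nofix conn] nofix by blast
  next
    case False
    then have "A \<union> f ` A \<noteq> ?V" using cardAf \<mu> assms(2) by auto
    \<comment> \<open>An unmatched \<open>u\<close> lies outside the vertex cover \<open>A\<close>,
      so its neighbour lies in \<open>A\<close> and is matched.\<close>
    then obtain u where u: "u \<in> ?V" "u \<notin> A" "f u = u" using fA(3) fixed by blast
    then obtain c where c: "c \<in> ?V" "(u, c) \<in> ?E" using nbr by blast
    then have "c \<in> A" using cover u unfolding stable_set_def by blast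
    then have fc: "f c \<noteq> c" using M(5) by blast
    have bound: "?bound = 2 ^ (card A - 1)" using False \<mu>(1) by simp
    show ?thesis
      unfolding bound
      using card_indep_transversals_unmatched[OF m finV irr u(1,3) c(1) fc c(2)] c(1) fc by blast
  qed
  then have upper: "card ?I \<le> ?bound" by (rule conjunct1)
  have le: "num_max_independent_sets T \<le> ?bound" using numI upper by (rule le_trans)
  have "2 * card A \<le> n" using card_mono[OF finV fA(3)] cardAf assms(2) by simp
  moreover have "card A \<ge> 1"
  proof (rule ccontr)
    assume "\<not> card A \<ge> 1"
    then have "A = {}" using finA by (simp add: not_le)
    obtain v where "v \<in> ?V" using ne by blast
    then show False using nbr cover \<open>A = {}\<close> unfolding stable_set_def by blast
  qed
  \<comment> \<open>The subtraction is not truncated as \<open>n - \<alpha> \<ge> 1\<close>. The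
    right side is the condition under which a spider has its one extra independent set.\<close>
  ultimately have eq\<alpha>: "2 * \<alpha> = n \<longleftrightarrow> \<alpha> = n - \<alpha> - 1 + 1" using \<mu> by auto
  have "\<exists>S :: 'a pair_pre_digraph. complete_bipartite_digraph 1 \<alpha> (with_proj S) \<and>
          arises_by_subdividing (n - \<alpha> - 1) S T"
    if eq: "num_max_independent_sets T = ?bound"
  proof -
    \<comment> \<open>Squeezed between the number of maximum independent sets and the bound,
      \<open>card ?I\<close> attains the bound too.\<close>
    have "card ?I = ?bound" using upper numI unfolding eq by (rule le_antisym)
    then obtain c where c: "c \<in> ?V" "f c \<noteq> c"
      "\<forall>y\<in>?V. \<forall>z\<in>?V. (y, z) \<in> ?E \<longrightarrow> y \<noteq> c \<longrightarrow> z \<noteq> c \<longrightarrow> z = f y"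
      using main by blast
    have edges: "z = f y" if "(y, z) \<in> ?E" "y \<noteq> c" "z \<noteq> c" for y z
      using c(3) that wellformed'[OF that(1)] by blast
    have "\<exists>L D h. spider T c L D h \<and> card D = card A - 1 \<and> card L + card A = card ?V"
    proof (rule spider_if_edges_at_centre[OF m conn _ c(1,2) edges])
      show "(x, z) \<notin> ?E" if "(x, y) \<in> ?E" "(y, z) \<in> ?E" for x y z
        using triangle_free[OF that] .
    qed
    then obtain L D h where "spider T c L D h" "card D = card A - 1" "card L + card A = n"
      unfolding assms(2) by blast
    moreover from this have "card L = \<alpha>" using \<mu> by simp
    ultimately show ?thesis using arises_by_subdividing_star_if_spider \<mu>(1) by metis
  qed
  moreover have "num_max_independent_sets T = ?bound"
    if S: "complete_bipartite_digraph 1 \<alpha> (with_proj S)" "arises_by_subdividing (n - \<alpha> - 1) S T"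
    for S :: "'a pair_pre_digraph"
  proof -
    obtain c L D h where sp: "spider T c L D h" "card L = \<alpha>" "card D = n - \<alpha> - 1"
      using spider_if_arises_by_subdividing_star[OF S] by blast
    \<comment> \<open>A lower bound suffices here, as the upper bound holds for every tree.\<close>
    have "?bound \<le> num_max_independent_sets T"
      using card_independent_sets_spider_ge[OF sp(1)] sp(2,3) eq\<alpha>
      unfolding num_max_independent_sets_def assms(3) by (auto split: if_splits)
    with le show ?thesis by (rule le_antisym)
  qed
  ultimately show ?thesis using le by blast
qed

end
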